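(* Let $\alpha,\beta>0$ with $\beta\neq\alpha$, and let $\gamma=\alpha$, $\delta=\beta$ (the isogram). The set of all configurations $(x,y,z,w)\in(\mathbb{R}\cup\{\infty\})^4$ of the planar 4-bar linkage with bar lengths $\alpha,\beta,\gamma,\delta$ is the union of the following two branches, each diffeomorphic to a circle $S^1$: (1) $\left\{\left(x,\ \dfrac1x,\ x,\ \dfrac1x\right) : x\in\mathbb{R}\cup\{\infty\}\right\}$; (2) $\left\{\left(x,\ \dfrac{\alpha+\beta}{(\alpha-\beta)x},\ -x,\ \dfrac{\beta+\alpha}{(\beta-\alpha)x}\right) : x\in\mathbb{R}\cup\{\infty\}\right\}$. Moreover, the configurations in which at least one of $x,y,z,w$ equals $\infty$ are exactly $(\infty,0,\infty,0)$ and $(0,\infty,0,\infty)$.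
   Context: $\mathbb{R}\cup\{\infty\}$ is the one-point compactification of $\mathbb{R}$, with the conventions $c/0=\infty$ and $c/\infty=0$ for real $c\ne0$, and $-\infty=\infty$. A planar 4-bar linkage has bar lengths $\alpha,\beta,\gamma,\delta>0$ in counter-clockwise cyclic order. Its configurations are described by rotational angles $\rho_x,\rho_y,\rho_z,\rho_w\in\mathbb{R}/2\pi\mathbb{Z}$, the (exterior) turning angles from bar $\alpha$ to $\beta$, from $\beta$ to $\gamma$, from $\gamma$ to $\delta$, and from $\delta$ to $\alpha$, respectively, when the closed quadrilateral is traversed once. Thus a quadruple of angles is a configuration if and only if $\rho_x+\rho_y+\rho_z+\rho_w\equiv 0 \pmod{2\pi}$ and $\beta+\gamma e^{i\rho_y}+\delta e^{i(\rho_y+\rho_z)}+\alpha e^{i(\rho_y+\rho_z+\rho_w)}=0$ (self-intersections and overlaps of bars are allowed). One writes $x=\tan\frac{\rho_x}{2}$, $y=\tan\frac{\rho_y}{2}$, $z=\tan\frac{\rho_z}{2}$, $w=\tan\frac{\rho_w}{2}$, with value $\infty$ when the angle is $\pi$, and identifies a configuration with $(x,y,z,w)\in(\mathbb{R}\cup\{\infty\})^4$. *)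

theory Defs
  imports "HOL-Analysis.Analysis" "HOL-Library.Real_Mod"
begin

section \<open>Smooth maps between subsets of manifolds\<close>

text \<open>
  Only used for open sets \<open>S\<close>: all iterated directional derivatives of \<open>f\<close> up to order \<open>n\<close>
  exist and are continuous on \<open>S\<close>.
\<close>

primrec Ck_on ::
  "nat \<Rightarrow> 'a::real_normed_vector set \<Rightarrow> ('a \<Rightarrow> 'b::real_normed_vector) \<Rightarrow> bool" where
  "Ck_on 0 S f \<longleftrightarrow> continuous_on S f"
| "Ck_on (Suc n) S f \<longleftrightarrow>
     (\<forall>x\<in>S. f differentiable (at x)) \<and>
     (\<forall>v. Ck_on n S (\<lambda>x. frechet_derivative f (at x) v))"

definition smooth_on ::
  "'a::real_normed_vector set \<Rightarrow> ('a \<Rightarrow> 'b::real_normed_vector) \<Rightarrow> bool" where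
  "smooth_on S f \<longleftrightarrow> (\<forall>n. Ck_on n S f)"

text \<open>A manifold is presented by an atlas, a set of charts (chart domain, coordinate map).\<close>

type_synonym ('a, 'e) atlas = "('a set \<times> ('a \<Rightarrow> 'e)) set"

definition prod_atlas :: "('a, 'e) atlas \<Rightarrow> ('b, 'f) atlas \<Rightarrow> ('a \<times> 'b, 'e \<times> 'f) atlas" where
  "prod_atlas \<A> \<B> = {(U \<times> V, map_prod \<phi> \<psi>) |U \<phi> V \<psi>. (U, \<phi>) \<in> \<A> \<and> (V, \<psi>) \<in> \<B>}"

definition vector_space_atlas :: "('e, 'e) atlas" where
  "vector_space_atlas = {(UNIV, id)}"

text \<open>
  For an arbitrary subset \<open>A\<close> of a manifold, a map on \<open>A\<close> is smooth if near each point of \<open>A\<close> it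
  is, in charts, the restriction of a smooth map defined on an open set. A subset diffeomorphic in
  this sense to a manifold is an embedded submanifold of the ambient manifold.
\<close>

definition smooth_map_between ::
  "('a, 'e::real_normed_vector) atlas \<Rightarrow> 'a set \<Rightarrow>
   ('b, 'f::real_normed_vector) atlas \<Rightarrow> 'b set \<Rightarrow> ('a \<Rightarrow> 'b) \<Rightarrow> bool" where
  "smooth_map_between \<A> A \<B> B f \<longleftrightarrow>
     f ` A \<subseteq> B \<and>
     (\<forall>p\<in>A. \<exists>(U, \<phi>)\<in>\<A>. \<exists>(V, \<psi>)\<in>\<B>. \<exists>W g.
        p \<in> U \<and> open W \<and> \<phi> p \<in> W \<and> smooth_on W g \<and>
        (\<forall>q\<in>A \<inter> U. \<phi> q \<in> W \<longrightarrow> f q \<in> V \<and> \<psi> (f q) = g (\<phi> q)))"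

definition diffeomorphic ::
  "('a, 'e::real_normed_vector) atlas \<Rightarrow> 'a set \<Rightarrow>
   ('b, 'f::real_normed_vector) atlas \<Rightarrow> 'b set \<Rightarrow> bool" where
  "diffeomorphic \<A> A \<B> B \<longleftrightarrow>
     (\<exists>f g. smooth_map_between \<A> A \<B> B f \<and> smooth_map_between \<B> B \<A> A g \<and>
            (\<forall>p\<in>A. g (f p) = p) \<and> (\<forall>q\<in>B. f (g q) = q))"

section \<open>The one-point compactification of the real line\<close>

text \<open>
  As in the library's \<^const>\<open>Alexandroff_compactification\<close>, the points are \<open>Some t\<close> for real \<open>t\<close>
  and the point at infinity \<^term>\<open>None\<close>.
\<close>

type_synonym real_infty = "real option"

abbreviation pt_infty :: real_infty  ("\<infinity>\<^sub>\<real>") where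
  "\<infinity>\<^sub>\<real> \<equiv> None"

fun divide_infty :: "real \<Rightarrow> real_infty \<Rightarrow> real_infty"  (infixl "'/\<^sub>\<infinity>" 70) where
  "c /\<^sub>\<infinity> None = Some 0"
| "c /\<^sub>\<infinity> Some t = (if t = 0 then \<infinity>\<^sub>\<real> else Some (c / t))"

text \<open>Only used for scalars \<open>c \<noteq> 0\<close>, to read the denominators \<open>c x\<close> at \<open>x = \<infinity>\<close>.\<close>

fun times_infty :: "real \<Rightarrow> real_infty \<Rightarrow> real_infty"  (infixl "*\<^sub>\<infinity>" 70) where
  "c *\<^sub>\<infinity> None = \<infinity>\<^sub>\<real>"
| "c *\<^sub>\<infinity> Some t = Some (c * t)"

fun uminus_infty :: "real_infty \<Rightarrow> real_infty"  ("-\<^sub>\<infinity> _" [81] 80) where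
  "-\<^sub>\<infinity> None = \<infinity>\<^sub>\<real>"
| "-\<^sub>\<infinity> Some t = Some (- t)"

text \<open>The two standard charts of the real projective line, with coordinates \<open>x\<close> and \<open>1/x\<close>.\<close>

definition atlas_infty :: "(real_infty, real) atlas" where
  "atlas_infty = {(- {\<infinity>\<^sub>\<real>}, the), (- {Some 0}, \<lambda>x. the (1 /\<^sub>\<infinity> x))}"

text \<open>The charts are homeomorphisms from open subsets of the compactification onto the line.\<close>

definition inv_coord :: "real \<Rightarrow> real_infty" where
  "inv_coord u = 1 /\<^sub>\<infinity> Some u"

lemma inv_coord_alt: "inv_coord u = (if u = 0 then \<infinity>\<^sub>\<real> else Some (1 / u))"
  by (simp add: inv_coord_def)

lemma openin_infty_iff:
  assumes "V \<subseteq> - {Some 0}"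
  shows "openin (Alexandroff_compactification euclideanreal) V \<longleftrightarrow> open (inv_coord -` V)"
proof
  assume "openin (Alexandroff_compactification euclideanreal) V"
  then consider U where "open U" "V = Some ` U"
    | C where "compact C" "V = insert None (Some ` (- C))"
    by (auto simp: openin_Alexandroff_compactification Compl_eq_Diff_UNIV)
  then show "open (inv_coord -` V)"
  proof cases
    case 1
    have "inv_coord -` V = (- {0}) \<inter> (\<lambda>u. 1 / u) -` U" by (auto simp: 1 inv_coord_alt split: if_splits)
    moreover have "open \<dots>"
      by (intro continuous_open_preimage continuous_intros 1) auto
    ultimately show ?thesis by simp
  next
    case 2
    have C0: "0 \<in> C" using assms 2 by auto
    obtain M where M: "M > 0" "\<And>c. c \<in> C \<Longrightarrow> \<bar>c\<bar> \<le> M"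
      using compact_imp_bounded[OF 2(1)] by (auto simp: bounded_pos)
    have "inv_coord -` V = {-1/M<..<1/M} \<union> ((- {0}) \<inter> (\<lambda>u. 1 / u) -` (- C))"
    proof -
      have "1 / u \<notin> C" if "u \<in> {-1/M<..<1/M}" "u \<noteq> 0" for u
      proof
        assume "1 / u \<in> C"
        then have "\<bar>1 / u\<bar> \<le> M" using M by blast
        moreover have "\<bar>u\<bar> < 1 / M" using that by auto
        ultimately show False using that M(1) by (auto simp: field_simps abs_mult)
      qed
      then show ?thesis using M(1) by (auto simp: 2 inv_coord_alt split: if_splits)
    qed
    moreover have "open \<dots>"
      by (intro open_Un continuous_open_preimage continuous_intros open_Compl
         compact_imp_closed 2) auto
    ultimately show ?thesis by simp
  qed
next
  assume o: "open (inv_coord -` V)"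
  show "openin (Alexandroff_compactification euclideanreal) V"
  proof (cases "None \<in> V")
    case False
    have "V = Some ` ((- {0}) \<inter> (\<lambda>u. 1 / u) -` (inv_coord -` V))"
    proof (intro equalityI subsetI)
      fix x assume "x \<in> V" with False assms show "x \<in> Some ` ((- {0}) \<inter> (\<lambda>u. 1 / u) -` (inv_coord -` V))"
        by (cases x) (auto simp: inv_coord_alt)
    qed (auto simp: inv_coord_alt split: if_splits)
    moreover have "open ((- {0}) \<inter> (\<lambda>u. 1 / u) -` (inv_coord -` V))"
      by (intro continuous_open_preimage continuous_intros o) auto
    ultimately show ?thesis by (auto simp: openin_Alexandroff_compactification)
  next
    case True
    then have "0 \<in> inv_coord -` V" by (simp add: inv_coord_alt)
    then obtain e where e: "e > 0" "ball 0 e \<subseteq> inv_coord -` V" using o openE by blast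
    define C where "C = - {t. Some t \<in> V}"
    have "V = insert None (Some ` (- C))"
      using True by (auto simp: C_def image_iff) (metis option.exhaust)
    moreover have "C = cball 0 (1/e) - (- {0}) \<inter> (\<lambda>u. 1 / u) -` (inv_coord -` V)"
    proof -
      have "Some t \<in> V" if "\<not> \<bar>t\<bar> \<le> 1 / e" for t
      proof -
        have "t \<noteq> 0" using that e by auto
        then have "1/t \<in> ball 0 e" using that e by (auto simp: field_simps abs_mult)
        then have "inv_coord (1/t) \<in> V" using e by blast
        with \<open>t \<noteq> 0\<close> show ?thesis by (simp add: inv_coord_alt)
      qed
      then have "\<bar>t\<bar> \<le> 1 / e" if "Some t \<notin> V" for t using that by blast
      then show ?thesis using assms by (auto simp: C_def inv_coord_alt split: if_splits)
    qed
    moreover have "compact (cball 0 (1/e) - (- {0}) \<inter> (\<lambda>u. 1 / u) -` (inv_coord -` V))"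
      by (intro compact_diff compact_cball continuous_open_preimage continuous_intros o) auto
    ultimately show ?thesis
      by (auto simp: openin_Alexandroff_compactification Compl_eq_Diff_UNIV intro: compact_imp_closed)
  qed
qed

lemma range_Some_eq: "range Some = - {\<infinity>\<^sub>\<real>}"
  by (auto simp: notin_range_Some)

lemma openin_chart_domain:
  assumes "(U, \<phi>) \<in> atlas_infty"
  shows "openin (Alexandroff_compactification euclideanreal) U"
proof -
  consider "U = - {\<infinity>\<^sub>\<real>}" | "U = - {Some 0}"
    using assms by (auto simp: atlas_infty_def)
  then show ?thesis
  proof cases
    case 1
    then have "U = Some ` UNIV" by (simp add: range_Some_eq)
    then show ?thesis by (auto simp: openin_Alexandroff_compactification)
  next
    case 2
    have "inv_coord -` (- {Some 0}) = UNIV" by (auto simp: inv_coord_alt)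
    then show ?thesis using 2 by (simp add: openin_infty_iff)
  qed
qed

lemma homeomorphic_map_chart:
  assumes "(U, \<phi>) \<in> atlas_infty"
  shows "homeomorphic_map (subtopology (Alexandroff_compactification euclideanreal) U)
           euclideanreal \<phi>"
proof -
  let ?X = "Alexandroff_compactification euclideanreal"
  have top: "topspace (subtopology ?X U) = U" by (auto simp add: range_Some_eq)
  have *: "homeomorphic_map (subtopology ?X U) euclideanreal \<phi>"
    if inv: "\<And>t. j t \<in> U \<and> \<phi> (j t) = t" "\<And>x. x \<in> U \<Longrightarrow> j (\<phi> x) = x"
      and op: "\<And>V. V \<subseteq> U \<Longrightarrow> openin ?X V \<longleftrightarrow> open (j -` V)" for j
  proof -
    have "t \<in> \<phi> ` U" for t
      using inv(1)[of t] by (auto intro: rev_image_eqI)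
    then have "\<phi> ` U = UNIV" by auto
    moreover have "openin (subtopology ?X U) {x \<in> U. \<phi> x \<in> W} \<longleftrightarrow> open W" for W
    proof -
      have "j -` {x \<in> U. \<phi> x \<in> W} = W" using inv by auto
      then show ?thesis
        using op[of "{x \<in> U. \<phi> x \<in> W}"] openin_chart_domain[OF assms]
        by (auto simp: openin_open_subtopology)
    qed
    moreover have "inj_on \<phi> U" using inv(2) by (rule inj_on_inverseI)
    ultimately show ?thesis
      unfolding homeomorphic_map_def quotient_map_def top by simp
  qed
  consider "U = - {\<infinity>\<^sub>\<real>}" "\<phi> = the" | "U = - {Some 0}" "\<phi> = (\<lambda>x. the (1 /\<^sub>\<infinity> x))"
    using assms by (auto simp: atlas_infty_def)
  then show ?thesis
  proof cases
    case 1
    show ?thesis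
    proof (rule *[of Some])
      fix V assume "V \<subseteq> U"
      then have "V \<subseteq> range Some" using 1 by (simp add: range_Some_eq)
      then have V: "Some ` (Some -` V) = V" by (simp add: image_vimage_eq Int_absorb2)
      have "openin ?X (Some ` (Some -` V)) \<longleftrightarrow> open (Some -` V)"
        by (simp only: openin_Alexandroff_compactification_image_Some flip: open_openin)
      then show "openin ?X V \<longleftrightarrow> open (Some -` V)" unfolding V .
    qed (use 1 in auto)
  next
    case 2
    show ?thesis
    proof (rule *[of inv_coord])
      show "inv_coord t \<in> U \<and> \<phi> (inv_coord t) = t" for t
        using 2 by (auto simp: inv_coord_alt)
      show "inv_coord (\<phi> x) = x" if "x \<in> U" for x
        using 2 that by (cases x) (auto simp: inv_coord_alt)
      show "openin ?X V \<longleftrightarrow> open (inv_coord -` V)" if "V \<subseteq> U" for V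
        using 2 that by (intro openin_infty_iff) simp
    qed
  qed
qed

type_synonym quadruple = "real_infty \<times> real_infty \<times> real_infty \<times> real_infty"

definition quadruple_atlas :: "(quadruple, real \<times> real \<times> real \<times> real) atlas" where
  "quadruple_atlas =
     prod_atlas atlas_infty (prod_atlas atlas_infty (prod_atlas atlas_infty atlas_infty))"

section \<open>Planar 4-bar linkages\<close>

text \<open>
  Elements of \<open>\<real>/2\<pi>\<int>\<close> are given by real representatives; by \<open>tan_half_eq_iff\<close> and \<open>surj_tan_half\<close>, the map \<open>tan_half\<close> induces
  a bijection from \<open>\<real>/2\<pi>\<int>\<close> onto the compactified line.
\<close>

definition tan_half :: "real \<Rightarrow> real_infty" where
  "tan_half \<rho> = (if [\<rho> = pi] (rmod (2 * pi)) then \<infinity>\<^sub>\<real> else Some (tan (\<rho> / 2)))"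

lemma cos_half_eq_0_iff: "cos (\<rho> / 2) = 0 \<longleftrightarrow> [\<rho> = pi] (rmod (2 * pi))"
proof -
  have "cos (\<rho> / 2) = 0 \<longleftrightarrow> cos \<rho> = -1"
    using cos_double_cos[of "\<rho>/2"] by (auto simp: power2_eq_1_iff)
  also have "\<dots> \<longleftrightarrow> cis \<rho> = cis pi"
    using sin_squared_eq[of \<rho>] by (auto simp: complex_eq_iff)
  finally show ?thesis by (simp only: cis_eq_iff)
qed

lemma tan_half_eq_iff: "tan_half \<rho> = tan_half \<sigma> \<longleftrightarrow> [\<rho> = \<sigma>] (rmod (2 * pi))"
proof -
  have cong: "[\<rho> = \<sigma>] (rmod (2 * pi)) \<longleftrightarrow> sin (\<rho> / 2 - \<sigma> / 2) = 0"
  proof -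
    have "sin (\<rho> / 2 - \<sigma> / 2) = 0 \<longleftrightarrow> cos (\<rho> - \<sigma>) = 1"
      using cos_double_sin[of "\<rho>/2 - \<sigma>/2"] by (auto simp: algebra_simps)
    also have "\<dots> \<longleftrightarrow> cis (\<rho> - \<sigma>) = cis 0"
      using sin_squared_eq[of "\<rho> - \<sigma>"] by (auto simp: complex_eq_iff)
    also have "\<dots> \<longleftrightarrow> cis \<rho> = cis \<sigma>"
      by (auto simp flip: cis_divide)
    finally show ?thesis by (simp add: cis_eq_iff)
  qed
  show ?thesis
  proof (cases "cos (\<rho> / 2) = 0 \<or> cos (\<sigma> / 2) = 0")
    case True
    then show ?thesis
      by (auto simp: tan_half_def cos_half_eq_0_iff rcong_sym_iff
          intro: rcong_trans rcong_sym)
  next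
    case False
    then have "tan (\<rho> / 2) = tan (\<sigma> / 2) \<longleftrightarrow> sin (\<rho> / 2 - \<sigma> / 2) = 0"
      by (simp add: tan_def sin_diff frac_eq_eq mult.commute)
    with False cong show ?thesis
      by (auto simp: tan_half_def cos_half_eq_0_iff)
  qed
qed

lemma surj_tan_half: "surj tan_half"
proof (rule surjI)
  fix x :: "real option"
  show "tan_half (case x of None \<Rightarrow> pi | Some t \<Rightarrow> 2 * arctan t) = x"
    by (cases x) (auto simp: tan_half_def tan_arctan simp flip: cos_half_eq_0_iff)
qed

definition is_configuration ::
  "real \<Rightarrow> real \<Rightarrow> real \<Rightarrow> real \<Rightarrow> real \<Rightarrow> real \<Rightarrow> real \<Rightarrow> real \<Rightarrow> bool" where
  "is_configuration \<alpha> \<beta> \<gamma> \<delta> \<rho>x \<rho>y \<rho>z \<rho>w \<longleftrightarrow>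
     [\<rho>x + \<rho>y + \<rho>z + \<rho>w = 0] (rmod (2 * pi)) \<and>
     of_real \<beta> + of_real \<gamma> * exp (\<i> * of_real \<rho>y)
       + of_real \<delta> * exp (\<i> * of_real (\<rho>y + \<rho>z))
       + of_real \<alpha> * exp (\<i> * of_real (\<rho>y + \<rho>z + \<rho>w)) = 0"

definition configurations :: "real \<Rightarrow> real \<Rightarrow> real \<Rightarrow> real \<Rightarrow> quadruple set" where
  "configurations \<alpha> \<beta> \<gamma> \<delta> =
     {(tan_half \<rho>x, tan_half \<rho>y, tan_half \<rho>z, tan_half \<rho>w) |\<rho>x \<rho>y \<rho>z \<rho>w.
        is_configuration \<alpha> \<beta> \<gamma> \<delta> \<rho>x \<rho>y \<rho>z \<rho>w}"

definition isogram_branch1 :: "quadruple set" where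
  "isogram_branch1 = {(x, 1 /\<^sub>\<infinity> x, x, 1 /\<^sub>\<infinity> x) |x. True}"

definition isogram_branch2 :: "real \<Rightarrow> real \<Rightarrow> quadruple set" where
  "isogram_branch2 \<alpha> \<beta> =
     {(x, (\<alpha> + \<beta>) /\<^sub>\<infinity> ((\<alpha> - \<beta>) *\<^sub>\<infinity> x), -\<^sub>\<infinity> x, (\<beta> + \<alpha>) /\<^sub>\<infinity> ((\<beta> - \<alpha>) *\<^sub>\<infinity> x)) |x. True}"

end

theory Submission
  imports Defs
begin

text \<open>
  The Cayley transform \<open>x \<mapsto> (1 + \<i> x) / (1 - \<i> x)\<close> turns half-angle tangents into points
  \<open>X, Y, Z, W\<close> of the unit circle, and closure becomes \<open>X Y Z W = 1\<close> together with
  \<open>\<beta> + \<alpha> Y = - Y Z (\<beta> + \<alpha> W)\<close>. Comparing absolute values gives \<open>Re Y = Re W\<close>, so \<open>W = Y\<close> or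
  \<open>W\<close> is the conjugate of \<open>Y\<close>; these two cases are the two branches. Both branches have the
  form \<open>(x, k/x, e x, m/x)\<close>, and such a curve is parametrised by the circle: where \<open>x\<close> is finite
  all of \<open>x, 1/y, z, 1/w\<close> are multiples of \<open>x\<close>, and elsewhere \<open>1/x, y, 1/z, w\<close> are multiples
  of \<open>1/x\<close>.
\<close>

section \<open>Smooth functions\<close>

lemma Ck_on_SucD:
  assumes "Ck_on (Suc n) S f" and "x \<in> S"
  shows "(f has_derivative frechet_derivative f (at x)) (at x)"
  using assms frechet_derivative_works by auto

text \<open>Derivatives at a point of an open set depend only on values in that set, so
  \<open>f\<close> and \<open>g\<close> share their derivatives on \<open>S\<close>. These
  derivatives again agree only on \<open>S\<close>, hence the induction over arbitrary
  \<open>f\<close> and \<open>g\<close>.\<close>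

lemma Ck_on_cong:
  assumes S: "open S" and "\<And>x. x \<in> S \<Longrightarrow> f x = g x" and "Ck_on n S f"
  shows "Ck_on n S g"
  using assms(2,3)
proof (induction n arbitrary: f g)
  case 0
  then show ?case using continuous_on_cong[of S S f g] by simp
next
  case (Suc n)
  have d: "(g has_derivative frechet_derivative f (at x)) (at x)" if "x \<in> S" for x
    using has_derivative_transform_within_open[OF Ck_on_SucD[OF Suc.prems(2) that] S that] Suc.prems(1)
    by blast
  have "Ck_on n S (\<lambda>x. frechet_derivative g (at x) v)" for v
  proof (rule Suc.IH)
    show "frechet_derivative f (at x) v = frechet_derivative g (at x) v" if "x \<in> S" for x
      using frechet_derivative_at[OF d[OF that]] by simp
    show "Ck_on n S (\<lambda>x. frechet_derivative f (at x) v)"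
      using Suc.prems(2) by simp
  qed
  then show ?case using d by (auto simp: differentiable_def)
qed

text \<open>\<open>Ck_on\<close> speaks of the chosen \<open>frechet_derivative\<close>. By
  uniqueness of derivatives any explicit \<open>f'\<close> may take its place, which is how every
  closure property below is proved.\<close>

lemma Ck_on_Suc_intro:
  assumes S: "open S" and d: "\<And>x. x \<in> S \<Longrightarrow> (f has_derivative f' x) (at x)"
    and c: "\<And>v. Ck_on n S (\<lambda>x. f' x v)"
  shows "Ck_on (Suc n) S f"
proof -
  have "f' x = frechet_derivative f (at x)" if "x \<in> S" for x
    using frechet_derivative_at[OF d[OF that]] .
  then have "Ck_on n S (\<lambda>x. frechet_derivative f (at x) v)" for v
    by (intro Ck_on_cong[OF S _ c[of v]]) simp
  then show ?thesis using d by (auto simp: differentiable_def)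
qed

lemma Ck_on_Suc_imp: "Ck_on (Suc n) S f \<Longrightarrow> Ck_on n S f"
proof (induction n arbitrary: f)
  case 0
  then show ?case
    by (auto intro!: continuous_at_imp_continuous_on differentiable_imp_continuous_within)
next
  case (Suc n)
  then show ?case by (metis Ck_on.simps(2))
qed

lemma Ck_on_const: "open S \<Longrightarrow> Ck_on n S (\<lambda>x. c)"
  by (induction n arbitrary: c) (auto intro!: Ck_on_Suc_intro[where f' = "\<lambda>x v. 0"])

lemma Ck_on_bounded_linear:
  assumes "open S" and "bounded_linear f"
  shows "Ck_on n S f"
proof (cases n)
  case 0
  then show ?thesis using assms(2) by (simp add: linear_continuous_on)
next
  case (Suc m)
  show ?thesis unfolding Suc
    by (rule Ck_on_Suc_intro[OF assms(1), where f' = "\<lambda>x. f"])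
      (auto intro: bounded_linear_imp_has_derivative assms Ck_on_const)
qed

lemma Ck_on_add:
  assumes "open S" and "Ck_on n S f" and "Ck_on n S g"
  shows "Ck_on n S (\<lambda>x. f x + g x)"
  using assms(2,3)
proof (induction n arbitrary: f g)
  case 0
  then show ?case by (simp add: continuous_on_add)
next
  case (Suc n)
  show ?case
  proof (rule Ck_on_Suc_intro[OF assms(1)])
    show "((\<lambda>x. f x + g x) has_derivative
        (\<lambda>v. frechet_derivative f (at x) v + frechet_derivative g (at x) v)) (at x)"
      if "x \<in> S" for x
      using Suc.prems that by (intro has_derivative_add Ck_on_SucD)
  qed (use Suc in simp)
qed

text \<open>By the product rule the derivative is a sum of two values of \<open>p\<close>, each
  pairing one of the functions with a derivative of the other; all four arguments are of class
  \<open>n\<close>, so the induction hypothesis applies. Multiplication and \<open>scaleR\<close>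
  are the instances of interest.\<close>

lemma Ck_on_bilinear:
  assumes S: "open S" and p: "bounded_bilinear p" and "Ck_on n S f" and "Ck_on n S g"
  shows "Ck_on n S (\<lambda>x. p (f x) (g x))"
  using assms(3,4)
proof (induction n arbitrary: f g)
  case 0
  then show ?case by (simp add: bounded_bilinear.continuous_on[OF p])
next
  case (Suc n)
  show ?case
  proof (rule Ck_on_Suc_intro[OF S])
    show "((\<lambda>x. p (f x) (g x)) has_derivative
        (\<lambda>v. p (f x) (frechet_derivative g (at x) v) + p (frechet_derivative f (at x) v) (g x))) (at x)"
      if "x \<in> S" for x
      using Suc.prems that by (intro bounded_bilinear.FDERIV[OF p] Ck_on_SucD)
    show "Ck_on n S (\<lambda>x. p (f x) (frechet_derivative g (at x) v)
        + p (frechet_derivative f (at x) v) (g x))" for v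
      using Suc.prems Ck_on_Suc_imp[OF Suc.prems(1)] Ck_on_Suc_imp[OF Suc.prems(2)]
      by (intro Ck_on_add[OF S] Suc.IH) auto
  qed
qed

text \<open>The derivative of \<open>1/f\<close> is \<open>- f'/f^2\<close>, a product of
  \<open>1/f\<close>, which the induction hypothesis controls, with \<open>f'\<close>, which is of
  class \<open>n\<close> by assumption.\<close>

lemma Ck_on_inverse:
  fixes f :: "'a::real_normed_vector \<Rightarrow> 'b::real_normed_field"
  assumes S: "open S" and nz: "\<And>x. x \<in> S \<Longrightarrow> f x \<noteq> 0" and "Ck_on n S f"
  shows "Ck_on n S (\<lambda>x. inverse (f x))"
  using assms(3)
proof (induction n)
  case 0
  then show ?case using nz by (simp add: continuous_on_inverse)
next
  case (Suc n)
  have inv: "Ck_on n S (\<lambda>x. inverse (f x))"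
    using Suc.IH Ck_on_Suc_imp[OF Suc.prems] .
  show ?case
  proof (rule Ck_on_Suc_intro[OF S])
    show "((\<lambda>x. inverse (f x)) has_derivative
        (\<lambda>v. - (inverse (f x) * frechet_derivative f (at x) v * inverse (f x)))) (at x)"
      if "x \<in> S" for x
      using Suc.prems that nz by (intro Deriv.has_derivative_inverse Ck_on_SucD)
    \<comment> \<open>The sign is written as a constant factor so that the product rule covers it
      too.\<close>
    have "Ck_on n S (\<lambda>x. (- 1) * (inverse (f x) * frechet_derivative f (at x) v * inverse (f x)))" for v
      using Suc.prems
      by (intro Ck_on_bilinear[OF S bounded_bilinear_mult] inv Ck_on_const[OF S]) auto
    then show "Ck_on n S (\<lambda>x. - (inverse (f x) * frechet_derivative f (at x) v * inverse (f x)))" for v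
      by simp
  qed
qed

lemma smooth_on_const: "open S \<Longrightarrow> smooth_on S (\<lambda>x. c)"
  and smooth_on_bounded_linear: "open S \<Longrightarrow> bounded_linear h \<Longrightarrow> smooth_on S h"
  and smooth_on_add:
    "open S \<Longrightarrow> smooth_on S f \<Longrightarrow> smooth_on S g \<Longrightarrow> smooth_on S (\<lambda>x. f x + g x)"
  and smooth_on_scaleR:
    "open S \<Longrightarrow> smooth_on S r \<Longrightarrow> smooth_on S f \<Longrightarrow> smooth_on S (\<lambda>x. r x *\<^sub>R f x)"
  by (simp_all add: smooth_on_def Ck_on_const Ck_on_bounded_linear Ck_on_add
      Ck_on_bilinear[OF _ bounded_bilinear_scaleR])

lemma smooth_on_divide:
  fixes f g :: "'a::real_normed_vector \<Rightarrow> 'b::real_normed_field"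
  assumes "open S" and "\<And>x. x \<in> S \<Longrightarrow> g x \<noteq> 0" and "smooth_on S f" and "smooth_on S g"
  shows "smooth_on S (\<lambda>x. f x / g x)"
  using assms
  by (simp add: smooth_on_def divide_inverse Ck_on_inverse Ck_on_bilinear[OF _ bounded_bilinear_mult])

section \<open>The Cayley transform\<close>

fun cayley :: "real_infty \<Rightarrow> complex" where
  "cayley None = - 1"
| "cayley (Some t) = (1 + \<i> * of_real t) / (1 - \<i> * of_real t)"

text \<open>This is stereographic projection of the unit circle from \<open>-1\<close>, or the
  half-angle formula tan(r/2) = sin r / (1 + cos r).\<close>

definition inv_cayley :: "complex \<Rightarrow> real_infty" where
  "inv_cayley q = (if Re q = - 1 then \<infinity>\<^sub>\<real> else Some (Im q / (1 + Re q)))"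

lemma one_minus_ii_nonzero: "1 - \<i> * complex_of_real t \<noteq> 0" "1 + \<i> * complex_of_real t \<noteq> 0"
  by (simp_all add: complex_eq_iff)

lemma one_plus_square_nonzero: "1 + (t::real)\<^sup>2 \<noteq> 0"
  using zero_le_power2[of t] by linarith

text \<open>The real part is not written as (1 - t^2)/(1 + t^2): in the present form
  \<open>1 + Re\<close>, the denominator in \<open>inv_cayley\<close>, can be read off and is
  visibly nonzero.\<close>

lemma Re_Im_cayley_Some:
  "Re (cayley (Some t)) = 2 / (1 + t\<^sup>2) - 1" "Im (cayley (Some t)) = 2 * t / (1 + t\<^sup>2)"
  using one_plus_square_nonzero[of t]
  by (simp_all add: Re_divide Im_divide power2_eq_square field_simps)

lemma norm_cayley: "norm (cayley x) = 1"
proof (cases x)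
  case (Some t)
  have "norm (1 + \<i> * complex_of_real t) = norm (1 - \<i> * complex_of_real t)"
    by (simp add: cmod_def)
  then show ?thesis using Some one_minus_ii_nonzero[of t] by (simp add: norm_divide)
qed simp

lemma inv_cayley_cayley: "inv_cayley (cayley x) = x"
proof (cases x)
  case (Some t)
  show ?thesis
    using one_plus_square_nonzero[of t]
    unfolding inv_cayley_def Some Re_Im_cayley_Some by simp
qed (simp add: inv_cayley_def)

lemma cayley_eq_iff: "cayley x = cayley y \<longleftrightarrow> x = y"
  by (metis inv_cayley_cayley)

lemma unit_circle_eq: "norm q = 1 \<longleftrightarrow> (Re q)\<^sup>2 + (Im q)\<^sup>2 = 1"
  by (simp add: cmod_def)

lemma cayley_inv_cayley:
  assumes "norm q = 1"
  shows "cayley (inv_cayley q) = q"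
proof (cases "Re q = -1")
  case True
  then have "q = -1" using assms by (simp add: unit_circle_eq complex_eq_iff)
  then show ?thesis by (simp add: inv_cayley_def)
next
  case False
  define c s where "c = Re q" and "s = Im q"
  have q: "q = Complex c s" by (simp add: c_def s_def)
  have nz: "1 + c \<noteq> 0" using False by (simp add: c_def)
  have s2: "s * s = 1 - c * c" using assms by (simp add: unit_circle_eq c_def s_def power2_eq_square)
  \<comment> \<open>The real parts agree because s^2/(1 + c) = 1 - c, the imaginary parts because s
    - c s/(1 + c) = s/(1 + c).\<close>
  have "1 + \<i> * complex_of_real (s / (1 + c)) = q * (1 - \<i> * complex_of_real (s / (1 + c)))"
    using nz s2 by (simp add: q complex_eq_iff field_simps)
  then have "cayley (Some (s / (1 + c))) = q"
    using one_minus_ii_nonzero(1)[of "s / (1 + c)"] by (simp add: field_simps)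
  then show ?thesis using False by (simp add: inv_cayley_def c_def s_def)
qed

text \<open>This is the bridge from angles to the unit circle. It is obtained by inverting tan(r/2)
  = sin r / (1 + cos r), with the angle pi treated apart.\<close>

lemma cayley_tan_half: "cayley (tan_half \<rho>) = cis \<rho>"
proof (cases "cos (\<rho> / 2) = 0")
  case True
  then have "cis \<rho> = cis pi" by (simp only: cos_half_eq_0_iff cis_eq_iff)
  then show ?thesis using True by (simp add: tan_half_def cos_half_eq_0_iff)
next
  case False
  have "inv_cayley (cis \<rho>) = tan_half \<rho>"
  proof -
    have c: "cos \<rho> = 2 * cos (\<rho> / 2) ^ 2 - 1" using cos_double_cos[of "\<rho> / 2"] by simp
    have s: "sin \<rho> = 2 * sin (\<rho> / 2) * cos (\<rho> / 2)" using sin_double[of "\<rho> / 2"] by simp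
    show ?thesis
      using False by (simp add: inv_cayley_def tan_half_def flip: cos_half_eq_0_iff)
        (simp add: c s tan_def power2_eq_square)
  qed
  then show ?thesis using cayley_inv_cayley[of "cis \<rho>"] by simp
qed

section \<open>Curves with coordinates proportional to x and 1/x\<close>

text \<open>A common form for both branches: the first has \<open>k = e = m = 1\<close>, the second
  \<open>e = - 1\<close> and \<open>m = - k\<close> with k = (\<alpha> + \<beta>)/(\<alpha> -
  \<beta>).\<close>

definition hyper_curve :: "real \<Rightarrow> real \<Rightarrow> real \<Rightarrow> real_infty \<Rightarrow> quadruple" where
  "hyper_curve k e m x = (x, k /\<^sub>\<infinity> x, e *\<^sub>\<infinity> x, m /\<^sub>\<infinity> x)"

definition dom_fin :: "quadruple set" where
  "dom_fin = (- {\<infinity>\<^sub>\<real>}) \<times> (- {Some 0}) \<times> (- {\<infinity>\<^sub>\<real>}) \<times> (- {Some 0})"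

text \<open>The coordinates are x, 1/y, z, 1/w because y and w become infinite where x = 0. In this
  chart, as in \<open>chart_inf\<close>, a \<open>hyper_curve\<close> is a straight line through the
  origin.\<close>

definition chart_fin :: "quadruple \<Rightarrow> real \<times> real \<times> real \<times> real" where
  "chart_fin = map_prod the (map_prod (\<lambda>x. the (1 /\<^sub>\<infinity> x)) (map_prod the (\<lambda>x. the (1 /\<^sub>\<infinity> x))))"

definition dom_inf :: "quadruple set" where
  "dom_inf = (- {Some 0}) \<times> (- {\<infinity>\<^sub>\<real>}) \<times> (- {Some 0}) \<times> (- {\<infinity>\<^sub>\<real>})"

definition chart_inf :: "quadruple \<Rightarrow> real \<times> real \<times> real \<times> real" where
  "chart_inf = map_prod (\<lambda>x. the (1 /\<^sub>\<infinity> x)) (map_prod the (map_prod (\<lambda>x. the (1 /\<^sub>\<infinity> x)) the))"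

lemma prod_atlasI:
  "(U, \<phi>) \<in> \<A> \<Longrightarrow> (V, \<psi>) \<in> \<B> \<Longrightarrow> (U \<times> V, map_prod \<phi> \<psi>) \<in> prod_atlas \<A> \<B>"
  unfolding prod_atlas_def by blast

lemma charts_in_quadruple_atlas:
  "(dom_fin, chart_fin) \<in> quadruple_atlas" "(dom_inf, chart_inf) \<in> quadruple_atlas"
proof -
  have F: "(- {\<infinity>\<^sub>\<real>}, the) \<in> atlas_infty" and I: "(- {Some 0}, \<lambda>x. the (1 /\<^sub>\<infinity> x)) \<in> atlas_infty"
    by (auto simp: atlas_infty_def)
  show "(dom_fin, chart_fin) \<in> quadruple_atlas" "(dom_inf, chart_inf) \<in> quadruple_atlas"
    unfolding quadruple_atlas_def dom_fin_def chart_fin_def dom_inf_def chart_inf_def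
    by (intro prod_atlasI F I)+
qed

lemma hyper_curve_in_dom:
  assumes "k \<noteq> 0" "e \<noteq> 0" "m \<noteq> 0"
  shows "hyper_curve k e m x \<in> dom_fin \<longleftrightarrow> x \<noteq> \<infinity>\<^sub>\<real>" "hyper_curve k e m x \<in> dom_inf \<longleftrightarrow> x \<noteq> Some 0"
  using assms by (cases x; auto simp: hyper_curve_def dom_fin_def dom_inf_def)+

lemma chart_fin_hyper_curve:
  assumes "k \<noteq> 0" "e \<noteq> 0" "m \<noteq> 0"
  shows "chart_fin (hyper_curve k e m (Some t)) = t *\<^sub>R (1::real, 1 / k, e, 1 / m)"
  using assms by (auto simp: hyper_curve_def chart_fin_def)

lemma chart_inf_hyper_curve:
  assumes "k \<noteq> 0" "e \<noteq> 0" "m \<noteq> 0"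
  shows "chart_inf (hyper_curve k e m (inv_coord u)) = u *\<^sub>R (1::real, k, 1 / e, m)"
  using assms by (auto simp: hyper_curve_def chart_inf_def inv_coord_alt)

text \<open>In the coordinate u = 1/x the transform is again a quotient with a denominator that
  vanishes for no real u, so it is smooth across x = infinity. The denominator is a sum so that
  \<open>smooth_on_add\<close> applies to it.\<close>

lemma cayley_inv_coord: "cayley (inv_coord u) = (of_real u + \<i>) / (of_real u + (- \<i>))"
proof (cases "u = 0")
  case False
  have nz: "complex_of_real u + (- \<i>) \<noteq> 0" by (simp add: complex_eq_iff)
  have "(1 + \<i> * of_real (1 / u)) * (complex_of_real u + (- \<i>)) = (of_real u + \<i>) * (1 - \<i> * of_real (1 / u))"
    using False by (simp add: complex_eq_iff field_simps)
  then show ?thesis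
    using False nz one_minus_ii_nonzero(1)[of "1 / u"] by (simp add: inv_coord_alt frac_eq_eq)
qed (simp add: inv_coord_alt)

text \<open>On the circle (Im q)^2 = (1 - Re q)(1 + Re q), so the reciprocal of Im q / (1 + Re q) is
  Im q / (1 - Re q), which stays smooth at q = -1.\<close>

lemma inv_cayley_eq_inv_coord:
  assumes "norm q = 1" "Re q \<noteq> 1"
  shows "inv_cayley q = inv_coord (Im q / (1 - Re q))"
proof -
  have s: "Im q * Im q = (1 - Re q) * (1 + Re q)"
    using assms(1) by (simp add: unit_circle_eq power2_eq_square algebra_simps)
  show ?thesis
  proof (cases "Re q = -1")
    case True
    then show ?thesis using s by (simp add: inv_cayley_def inv_coord_alt)
  next
    case False
    then have "1 + Re q \<noteq> 0" "1 - Re q \<noteq> 0" using assms by auto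
    moreover from this s have "Im q \<noteq> 0" by auto
    ultimately show ?thesis using s False by (simp add: inv_cayley_def inv_coord_alt frac_eq_eq mult.commute)
  qed
qed

section \<open>Diffeomorphism of these curves with the unit circle\<close>

lemma smooth_map_between_two_chartsI:
  assumes "f ` A \<subseteq> B"
    and chart: "(U, \<phi>) \<in> \<A>" "(V, \<psi>) \<in> \<B>" "open W" "smooth_on W g"
      "\<And>q. q \<in> A \<Longrightarrow> q \<in> U \<Longrightarrow> \<phi> q \<in> W \<Longrightarrow> f q \<in> V \<and> \<psi> (f q) = g (\<phi> q)"
    and chart': "(U', \<phi>') \<in> \<A>" "(V', \<psi>') \<in> \<B>" "open W'" "smooth_on W' g'"
      "\<And>q. q \<in> A \<Longrightarrow> q \<in> U' \<Longrightarrow> \<phi>' q \<in> W' \<Longrightarrow> f q \<in> V' \<and> \<psi>' (f q) = g' (\<phi>' q)"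
    and cover: "\<And>p. p \<in> A \<Longrightarrow> p \<in> U \<and> \<phi> p \<in> W \<or> p \<in> U' \<and> \<phi>' p \<in> W'"
  shows "smooth_map_between \<A> A \<B> B f"
  unfolding smooth_map_between_def
proof (intro conjI ballI assms(1))
  fix p assume "p \<in> A"
  then consider "p \<in> U" "\<phi> p \<in> W" | "p \<in> U'" "\<phi>' p \<in> W'"
    using cover by blast
  then show "\<exists>(U, \<phi>)\<in>\<A>. \<exists>(V, \<psi>)\<in>\<B>. \<exists>W g.
      p \<in> U \<and> open W \<and> \<phi> p \<in> W \<and> smooth_on W g \<and>
      (\<forall>q\<in>A \<inter> U. \<phi> q \<in> W \<longrightarrow> f q \<in> V \<and> \<psi> (f q) = g (\<phi> q))"
  proof cases
    case 1
    then show ?thesis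
      using chart by (intro bexI[OF _ chart(1)] case_prodI bexI[OF _ chart(2)] exI[of _ W] exI[of _ g]) auto
  next
    case 2
    then show ?thesis
      using chart' by (intro bexI[OF _ chart'(1)] case_prodI bexI[OF _ chart'(2)] exI[of _ W'] exI[of _ g']) auto
  qed
qed

text \<open>The first chart coordinate is x or 1/x, and the transform is a quotient of affine
  functions of either one. These quotients depend on that coordinate alone and so extend smoothly to
  the whole coordinate space.\<close>

lemma smooth_cayley_fst:
  assumes nz: "k \<noteq> 0" "e \<noteq> 0" "m \<noteq> 0"
  shows "smooth_map_between quadruple_atlas (range (hyper_curve k e m))
     vector_space_atlas (sphere 0 1) (\<lambda>p. cayley (fst p))"
proof -
  define N where "N = (\<lambda>v::real \<times> real \<times> real \<times> real. complex_of_real (fst v))"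
  have N: "smooth_on UNIV N" and iN: "smooth_on UNIV (\<lambda>v. \<i> * N v)"
    and miN: "smooth_on UNIV (\<lambda>v. (- \<i>) * N v)"
    unfolding N_def
    by (intro smooth_on_bounded_linear bounded_linear_const_mult
        bounded_linear_compose[OF bounded_linear_of_real] bounded_linear_fst open_UNIV)+
  have id: "(UNIV, id) \<in> vector_space_atlas" by (simp add: vector_space_atlas_def)
  show ?thesis
  proof (rule smooth_map_between_two_chartsI[OF _ charts_in_quadruple_atlas(1) id open_UNIV _ _
        charts_in_quadruple_atlas(2) id open_UNIV])
    show "(\<lambda>p. cayley (fst p)) ` range (hyper_curve k e m) \<subseteq> sphere 0 1"
      by (auto simp: norm_cayley)
    have "1 + (- \<i>) * N v \<noteq> 0" for v
      using one_minus_ii_nonzero(1) by (simp add: N_def)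
    then show "smooth_on UNIV (\<lambda>v. (1 + \<i> * N v) / (1 + (- \<i>) * N v))"
      by (intro smooth_on_divide smooth_on_add smooth_on_const iN miN open_UNIV)
    have "N v + (- \<i>) \<noteq> 0" for v
      by (simp add: N_def complex_eq_iff)
    then show "smooth_on UNIV (\<lambda>v. (N v + \<i>) / (N v + (- \<i>)))"
      by (intro smooth_on_divide smooth_on_add smooth_on_const N open_UNIV)
  next
    fix q assume q: "q \<in> range (hyper_curve k e m)" "q \<in> dom_fin"
    then obtain y where y: "q = hyper_curve k e m y" by auto
    with q hyper_curve_in_dom(1)[OF nz] obtain t where "y = Some t" by auto
    with y show "cayley (fst q) \<in> UNIV \<and>
        id (cayley (fst q)) = (1 + \<i> * N (chart_fin q)) / (1 + (- \<i>) * N (chart_fin q))"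
      by (simp add: chart_fin_hyper_curve[OF nz] N_def) (simp add: hyper_curve_def)
  next
    fix q assume q: "q \<in> range (hyper_curve k e m)" "q \<in> dom_inf"
    then obtain y where y: "q = hyper_curve k e m y" by auto
    with q have "y \<noteq> Some 0" using hyper_curve_in_dom(2)[OF nz] by simp
    then have u: "y = inv_coord (the (1 /\<^sub>\<infinity> y))" by (cases y) (auto simp: inv_coord_alt)
    have "chart_inf q = the (1 /\<^sub>\<infinity> y) *\<^sub>R (1, k, 1 / e, m)"
      using chart_inf_hyper_curve[OF nz] y u by metis
    moreover have "cayley (fst q) = cayley (inv_coord (the (1 /\<^sub>\<infinity> y)))"
      using y u by (simp add: hyper_curve_def)
    ultimately show "cayley (fst q) \<in> UNIV \<and>
        id (cayley (fst q)) = (N (chart_inf q) + \<i>) / (N (chart_inf q) + (- \<i>))"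
      by (simp add: N_def cayley_inv_coord)
  qed (auto simp: hyper_curve_in_dom[OF nz])
qed

text \<open>In either chart the map is a real quotient times a constant vector. The quotients extend
  to the plane without the vertical line through -1 or through 1, and these two open sets cover the
  circle.\<close>

lemma smooth_hyper_curve_inv_cayley:
  assumes nz: "k \<noteq> 0" "e \<noteq> 0" "m \<noteq> 0"
  shows "smooth_map_between vector_space_atlas (sphere 0 1) quadruple_atlas
     (range (hyper_curve k e m)) (\<lambda>q. hyper_curve k e m (inv_cayley q))"
proof -
  have id: "(UNIV, id) \<in> vector_space_atlas" by (simp add: vector_space_atlas_def)
  have op: "open {q. Re q \<noteq> c}" for c
    by (intro open_Collect_neq continuous_intros)
  have Re: "smooth_on S Re" and mRe: "smooth_on S (\<lambda>q. - Re q)" and Im: "smooth_on S Im"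
    if "open S" for S
    by (intro smooth_on_bounded_linear that bounded_linear_Re bounded_linear_Im
        bounded_linear_minus)+
  show ?thesis
  proof (rule smooth_map_between_two_chartsI[OF _ id charts_in_quadruple_atlas(1) op _ _
        id charts_in_quadruple_atlas(2) op])
    show "(\<lambda>q. hyper_curve k e m (inv_cayley q)) ` sphere 0 1 \<subseteq> range (hyper_curve k e m)"
      by auto
    show "smooth_on {q. Re q \<noteq> -1} (\<lambda>q. (Im q / (1 + Re q)) *\<^sub>R (1, 1 / k, e, 1 / m))"
      by (intro smooth_on_scaleR smooth_on_divide smooth_on_add smooth_on_const Re Im op) auto
    show "smooth_on {q. Re q \<noteq> 1} (\<lambda>q. (Im q / (1 + (- Re q))) *\<^sub>R (1, k, 1 / e, m))"
      by (intro smooth_on_scaleR smooth_on_divide smooth_on_add smooth_on_const mRe Im op) auto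
  next
    fix q :: complex assume "id q \<in> {q. Re q \<noteq> -1}"
    then have "inv_cayley q = Some (Im q / (1 + Re q))" by (simp add: inv_cayley_def)
    then show "hyper_curve k e m (inv_cayley q) \<in> dom_fin \<and> chart_fin (hyper_curve k e m (inv_cayley q)) =
        (Im (id q) / (1 + Re (id q))) *\<^sub>R (1, 1 / k, e, 1 / m)"
      by (simp add: hyper_curve_in_dom[OF nz] chart_fin_hyper_curve[OF nz])
  next
    fix q :: complex assume "q \<in> sphere 0 1" "id q \<in> {q. Re q \<noteq> 1}"
    then have "inv_cayley q = inv_coord (Im q / (1 - Re q))" by (simp add: inv_cayley_eq_inv_coord)
    moreover have "inv_coord u \<noteq> Some 0" for u by (simp add: inv_coord_alt)
    ultimately show "hyper_curve k e m (inv_cayley q) \<in> dom_inf \<and> chart_inf (hyper_curve k e m (inv_cayley q)) =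
        (Im (id q) / (1 + (- Re (id q)))) *\<^sub>R (1, k, 1 / e, m)"
      by (simp add: hyper_curve_in_dom[OF nz] chart_inf_hyper_curve[OF nz])
  qed auto
qed

lemma diffeomorphic_hyper_curve_circle:
  assumes "k \<noteq> 0" "e \<noteq> 0" "m \<noteq> 0"
  shows "diffeomorphic quadruple_atlas (range (hyper_curve k e m))
    vector_space_atlas (sphere (0::complex) 1)"
  unfolding diffeomorphic_def
proof (intro exI conjI ballI)
  show "smooth_map_between quadruple_atlas (range (hyper_curve k e m))
     vector_space_atlas (sphere 0 1) (\<lambda>p. cayley (fst p))"
    using assms by (rule smooth_cayley_fst)
  show "smooth_map_between vector_space_atlas (sphere 0 1) quadruple_atlas
     (range (hyper_curve k e m)) (\<lambda>q. hyper_curve k e m (inv_cayley q))"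
    using assms by (rule smooth_hyper_curve_inv_cayley)
qed (auto simp: hyper_curve_def inv_cayley_cayley cayley_inv_cayley)

section \<open>Configurations\<close>

text \<open>Angles disappear here: e^(i r) is the Cayley transform of the half-angle tangent, so a
  sum of angles becomes a product. The converse needs angles with prescribed tangents, which
  \<open>surj_tan_half\<close> supplies.\<close>

lemma configurations_iff:
  "(x, y, z, w) \<in> configurations \<alpha> \<beta> \<gamma> \<delta> \<longleftrightarrow>
    cayley x * cayley y * cayley z * cayley w = 1 \<and>
    of_real \<beta> + of_real \<gamma> * cayley y + of_real \<delta> * (cayley y * cayley z)
      + of_real \<alpha> * (cayley y * cayley z * cayley w) = 0"
proof -
  define closes where "closes X Y Z W \<longleftrightarrow> X * Y * Z * W = 1 \<and>
    of_real \<beta> + of_real \<gamma> * Y + of_real \<delta> * (Y * Z) + of_real \<alpha> * (Y * Z * W) = 0"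
    for X Y Z W :: complex
  have conf: "is_configuration \<alpha> \<beta> \<gamma> \<delta> a b c d \<longleftrightarrow>
      closes (cayley (tan_half a)) (cayley (tan_half b)) (cayley (tan_half c)) (cayley (tan_half d))"
    for a b c d
    unfolding is_configuration_def closes_def cayley_tan_half cis_eq_iff[symmetric]
      cis_conv_exp[symmetric]
    by (simp add: cis_mult)
  have "closes (cayley x) (cayley y) (cayley z) (cayley w)"
    if "(x, y, z, w) \<in> configurations \<alpha> \<beta> \<gamma> \<delta>"
    using that unfolding configurations_def conf by auto
  moreover have "(x, y, z, w) \<in> configurations \<alpha> \<beta> \<gamma> \<delta>"
    if closes: "closes (cayley x) (cayley y) (cayley z) (cayley w)"
  proof -
    obtain a b c d where tan_half: "x = tan_half a" "y = tan_half b" "z = tan_half c" "w = tan_half d"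
      using surjD[OF surj_tan_half, of x] surjD[OF surj_tan_half, of y]
        surjD[OF surj_tan_half, of z] surjD[OF surj_tan_half, of w] by auto
    moreover have "is_configuration \<alpha> \<beta> \<gamma> \<delta> a b c d"
      using closes unfolding conf tan_half .
    ultimately show ?thesis unfolding configurations_def by auto
  qed
  ultimately show ?thesis unfolding closes_def[symmetric] by blast
qed

section \<open>The closure equation as algebra on the unit circle\<close>

text \<open>Two vectors of different lengths cannot cancel. This is how \<beta> \<noteq> \<alpha>
  enters: the diagonal of the linkage never collapses to a point.\<close>

lemma affine_unit_nonzero:
  fixes a b :: real and X :: complex
  assumes "norm X = 1" "\<bar>a\<bar> \<noteq> \<bar>b\<bar>"
  shows "of_real a + of_real b * X \<noteq> 0"
proof
  assume "of_real a + of_real b * X = 0"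
  then have "of_real b * X = - of_real a" by (simp add: add_eq_0_iff)
  then have "norm (of_real b * X) = norm (- complex_of_real a)" by (simp only:)
  then have "\<bar>b\<bar> = \<bar>a\<bar>"
    by (simp only: norm_mult norm_of_real norm_minus_cancel assms(1) mult_1_right)
  then show False using assms(2) by simp
qed

lemma cayley_uminus: "cayley ((- 1) *\<^sub>\<infinity> x) = cnj (cayley x)"
  by (cases x) auto

text \<open>Write X, Y for the transforms of finite x, y. Multiplying by (1 - i x)(1 - i y) turns 1
  + X Y into 2 (1 - x y) and X + Y into 2 (1 + x y), so the left side becomes 4 (a - d x y), which
  vanishes for x y = a/d. In the degenerate cases the transform of y is 1 or -1.\<close>

lemma cayley_divide:
  assumes "d \<noteq> 0"
  shows "of_real (a + d) + of_real (a - d) * cayley ((a / d) /\<^sub>\<infinity> x)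
    + (of_real (a - d) + of_real (a + d) * cayley ((a / d) /\<^sub>\<infinity> x)) * cayley x = 0"
proof (cases x)
  case (Some t)
  show ?thesis
  proof (cases "a * t = 0")
    case False
    define A D T :: complex where "A = of_real a" and "D = of_real d" and "T = of_real t"
    have nz: "1 - \<i> * T \<noteq> 0" using one_minus_ii_nonzero by (simp add: T_def)
    have y: "(a / d) /\<^sub>\<infinity> x = inv_coord (d * t / a)"
      using Some False assms by (simp add: inv_coord_alt)
    have c: "cayley ((a / d) /\<^sub>\<infinity> x) = (D * T + \<i> * A) / (D * T - \<i> * A)"
      using False unfolding y cayley_inv_coord A_def D_def T_def by (simp add: divide_simps)
    have nz': "D * T - \<i> * A \<noteq> 0"
      using False by (simp add: A_def D_def T_def complex_eq_iff)
    have x: "cayley x = (1 + \<i> * T) / (1 - \<i> * T)" using Some by (simp add: T_def)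
    have "(A + D) + (A - D) * ((D * T + \<i> * A) / (D * T - \<i> * A))
      + ((A - D) + (A + D) * ((D * T + \<i> * A) / (D * T - \<i> * A))) * ((1 + \<i> * T) / (1 - \<i> * T))
      = (((A + D) * (D * T - \<i> * A) + (A - D) * (D * T + \<i> * A)) * (1 - \<i> * T)
      + ((A - D) * (D * T - \<i> * A) + (A + D) * (D * T + \<i> * A)) * (1 + \<i> * T))
        / ((D * T - \<i> * A) * (1 - \<i> * T))"
      using nz nz' by (simp add: divide_simps)
    also have "((A + D) * (D * T - \<i> * A) + (A - D) * (D * T + \<i> * A)) * (1 - \<i> * T)
      + ((A - D) * (D * T - \<i> * A) + (A + D) * (D * T + \<i> * A)) * (1 + \<i> * T) = 0"
      by (simp add: algebra_simps)
    finally show ?thesis by (simp add: c x A_def D_def T_def)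
  qed (use Some in auto)
qed simp

text \<open>Passing from x to 1/x replaces the angle r by pi - r, and e^(i (pi - r)) is minus the
  conjugate of e^(i r).\<close>

lemma cayley_one_divide: "cayley (1 /\<^sub>\<infinity> x) = - cnj (cayley x)"
proof (cases x)
  case (Some t)
  have nz: "complex_of_real t + (- \<i>) \<noteq> 0" by (simp add: complex_eq_iff)
  have "(of_real t + \<i>) * (1 + \<i> * of_real t) = - (1 - \<i> * of_real t) * (complex_of_real t + (- \<i>))"
    by (simp add: algebra_simps)
  then have "(complex_of_real t + \<i>) / (of_real t + (- \<i>)) = - (1 - \<i> * of_real t) / (1 + \<i> * of_real t)"
    by (rule frac_eq_eq[OF nz one_minus_ii_nonzero(2), THEN iffD2])
  moreover have "cayley (1 /\<^sub>\<infinity> x) = (complex_of_real t + \<i>) / (of_real t + (- \<i>))"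
    unfolding Some inv_coord_def[symmetric] by (rule cayley_inv_coord)
  moreover have "- cnj (cayley x) = - (1 - \<i> * of_real t) / (1 + \<i> * of_real t)"
    unfolding minus_divide_left[symmetric] using Some by simp
  ultimately show ?thesis by simp
qed simp

text \<open>This is the law of cosines; for a b \<noteq> 0 the length therefore determines
  \<open>Re X\<close>.\<close>

lemma norm_affine_unit_squared:
  fixes a b :: real
  assumes "norm X = 1"
  shows "(norm (of_real a + of_real b * X))\<^sup>2 = a\<^sup>2 + b\<^sup>2 + 2 * a * b * Re X"
proof -
  have "(norm (of_real a + of_real b * X))\<^sup>2 = (a + b * Re X)\<^sup>2 + (b * Im X)\<^sup>2"
    by (simp add: cmod_power2)
  also have "\<dots> = a\<^sup>2 + b\<^sup>2 * ((Re X)\<^sup>2 + (Im X)\<^sup>2) + 2 * a * b * Re X"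
    by (simp add: power2_eq_square algebra_simps)
  finally show ?thesis using assms by (simp add: unit_circle_eq)
qed

text \<open>
  The last equation is \<open>X = - (\<alpha> + \<beta> Y) / (\<beta> + \<alpha> Y)\<close>, the relation between \<open>x\<close> and \<open>y\<close> in the
  second branch.
\<close>

lemma unit_isogram_cases:
  fixes X Y Z W :: complex and \<alpha> \<beta> :: real
  assumes X: "norm X = 1" and Y: "norm Y = 1" and Z: "norm Z = 1" and W: "norm W = 1"
    and "\<alpha> > 0" "\<beta> > 0" "\<beta> \<noteq> \<alpha>"
  shows "X * Y * Z * W = 1 \<and>
      of_real \<beta> + of_real \<alpha> * Y + of_real \<beta> * (Y * Z) + of_real \<alpha> * (Y * Z * W) = 0 \<longleftrightarrow>
    (Y = - cnj X \<and> Z = X \<and> W = - cnj X) \<or>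
    (Z = cnj X \<and> W = cnj Y \<and>
      of_real \<alpha> + of_real \<beta> * Y + (of_real \<beta> + of_real \<alpha> * Y) * X = 0)" (is "?L \<longleftrightarrow> ?B1 \<or> ?B2")
proof -
  define A B :: complex where "A = of_real \<alpha>" and "B = of_real \<beta>"
  define X' Y' where "X' = cnj X" and "Y' = cnj Y"
  have XX: "X * X' = 1" using X by (simp add: X'_def complex_norm_square[symmetric])
  have YY: "Y * Y' = 1" using Y by (simp add: Y'_def complex_norm_square[symmetric])
  have P: "B + A * Y \<noteq> 0"
    unfolding A_def B_def using Y assms(5-7) by (intro affine_unit_nonzero) auto
  \<comment> \<open>The bracket on the right is the closure sum for Z = X', W = Y', where Y Z W
    reduces to X'. Up to the unit factor X, closure and the second-branch relation thus
    coincide.\<close>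
  have turn: "(A + B * Y) + (B + A * Y) * X = X * (B + A * Y + B * (Y * X') + A * X')"
    using XX by algebra
  have L: "?B1 \<or> ?B2" if "X * Y * Z * W = 1" and cl: "B + A * Y + B * (Y * Z) + A * (Y * Z * W) = 0"
  proof -
    \<comment> \<open>A diagonal cuts the quadrilateral into two pairs of bars; both pairs must span
      the same diagonal length.\<close>
    have eq: "B + A * Y = - (Y * Z) * (B + A * W)" using cl by algebra
    then have "norm (B + A * Y) = norm (B + A * W)"
      using Y Z by (simp add: norm_mult)
    then have "(norm (B + A * Y))\<^sup>2 = (norm (B + A * W))\<^sup>2" by simp
    then have Re: "Re Y = Re W"
      unfolding A_def B_def using assms(5,6) by (simp add: norm_affine_unit_squared Y W)
    then have "(Im Y)\<^sup>2 = (Im W)\<^sup>2" using Y W by (simp add: unit_circle_eq)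
    then have "W = Y \<or> W = Y'" using Re by (auto simp: power2_eq_iff complex_eq_iff Y'_def)
    then show ?thesis
    proof
      assume "W = Y"
      \<comment> \<open>For W = Y both sides of \<open>eq\<close> contain the diagonal B + A Y,
        which is nonzero by \<open>P\<close> and cancels.\<close>
      have "(B + A * Y) * (1 + Y * Z) = 0" using eq unfolding \<open>W = Y\<close> by algebra
      then have YZ: "1 + Y * Z = 0" using P by simp
      then have "W * X = -1" using \<open>X * Y * Z * W = 1\<close> by algebra
      then have "W = - X'" using XX by algebra
      moreover have "Z = X" using YZ \<open>W = Y\<close> \<open>W = - X'\<close> XX by algebra
      ultimately show ?thesis using \<open>W = Y\<close> by (simp add: X'_def)
    next
      assume W: "W = Y'"
      have "X * Z = 1" using YY \<open>X * Y * Z * W = 1\<close> unfolding W by algebra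
      then have Z: "Z = X'" using XX by algebra
      have "B + A * Y + B * (Y * X') + A * X' = 0" using cl YY unfolding Z W by algebra
      then have "(A + B * Y) + (B + A * Y) * X = 0" using turn by simp
      then show ?thesis using W Z by (simp add: A_def B_def X'_def Y'_def)
    qed
  qed
  have R1: "X * Y * Z * W = 1 \<and> B + A * Y + B * (Y * Z) + A * (Y * Z * W) = 0"
    if "Y = - X'" "Z = X" "W = - X'"
  proof
    show "X * Y * Z * W = 1" using that XX by algebra
    show "B + A * Y + B * (Y * Z) + A * (Y * Z * W) = 0" using that XX by algebra
  qed
  have R2: "X * Y * Z * W = 1 \<and> B + A * Y + B * (Y * Z) + A * (Y * Z * W) = 0"
    if "Z = X'" "W = Y'" and e: "(A + B * Y) + (B + A * Y) * X = 0"
  proof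
    show "X * Y * Z * W = 1" using XX YY unfolding that(1,2) by algebra
    have "X \<noteq> 0" using X by auto
    then have "B + A * Y + B * (Y * X') + A * X' = 0" using turn e by simp
    then show "B + A * Y + B * (Y * Z) + A * (Y * Z * W) = 0" using YY unfolding that(1,2) by algebra
  qed
  show ?thesis
  proof
    assume ?L
    then show "?B1 \<or> ?B2" using L unfolding A_def B_def by (elim conjE)
  next
    assume "?B1 \<or> ?B2"
    then show ?L
    proof (elim disjE conjE)
      assume "Y = - cnj X" "Z = X" "W = - cnj X"
      then show ?L by (rule R1[unfolded A_def B_def X'_def])
    next
      assume "Z = cnj X" "W = cnj Y"
        "of_real \<alpha> + of_real \<beta> * Y + (of_real \<beta> + of_real \<alpha> * Y) * X = 0"
      then show ?L by (rule R2[unfolded A_def B_def X'_def Y'_def])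
    qed
  qed
qed

text \<open>The relation is affine in the transform of y with leading coefficient B + A X \<noteq>
  0, so it has at most one solution, and \<open>cayley_divide\<close> exhibits one.\<close>

lemma cayley_branch2_iff:
  assumes "\<alpha> > 0" "\<beta> > 0" "\<beta> \<noteq> \<alpha>"
  shows "of_real \<alpha> + of_real \<beta> * cayley y + (of_real \<beta> + of_real \<alpha> * cayley y) * cayley x = 0 \<longleftrightarrow>
    y = ((\<alpha> + \<beta>) / (\<alpha> - \<beta>)) /\<^sub>\<infinity> x"
proof -
  define A B X Y where "A = complex_of_real \<alpha>" and "B = complex_of_real \<beta>" and "X = cayley x"
    and "Y = cayley (((\<alpha> + \<beta>) / (\<alpha> - \<beta>)) /\<^sub>\<infinity> x)"
  \<comment> \<open>With d = \<alpha> - \<beta> and a = \<alpha> + \<beta> one has a + d = 2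
    \<alpha> and a - d = 2 \<beta>, whence the factor 2.\<close>
  have "2 * (A + B * Y + (B + A * Y) * X) = 0"
    using cayley_divide[of "\<alpha> - \<beta>" "\<alpha> + \<beta>" x] assms(3)
    by (simp add: A_def B_def X_def Y_def algebra_simps)
  then have "A + B * Y + (B + A * Y) * X = 0" by (metis mult_eq_0_iff zero_neq_numeral)
  then have "A + B * cayley y + (B + A * cayley y) * X = (B + A * X) * (cayley y - Y)"
    by algebra
  moreover have "B + A * X \<noteq> 0"
    unfolding A_def B_def X_def using assms by (intro affine_unit_nonzero) (auto simp: norm_cayley)
  ultimately have "A + B * cayley y + (B + A * cayley y) * X = 0 \<longleftrightarrow> cayley y = Y" by simp
  then show ?thesis unfolding A_def B_def X_def Y_def cayley_eq_iff .
qed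

lemma isogram_configurations:
  assumes "\<alpha> > 0" "\<beta> > 0" "\<beta> \<noteq> \<alpha>"
  shows "configurations \<alpha> \<beta> \<alpha> \<beta> = range (hyper_curve 1 1 1) \<union>
    range (hyper_curve ((\<alpha> + \<beta>) / (\<alpha> - \<beta>)) (- 1) ((\<beta> + \<alpha>) / (\<beta> - \<alpha>)))"
proof -
  define k m where "k = (\<alpha> + \<beta>) / (\<alpha> - \<beta>)" and "m = (\<beta> + \<alpha>) / (\<beta> - \<alpha>)"
  have m: "m = - k"
    unfolding k_def m_def minus_divide_right by (simp add: add.commute)
  \<comment> \<open>In the second branch w is obtained as -y; this puts it into the stated form
    m/x.\<close>
  have neg: "(- 1) *\<^sub>\<infinity> (k /\<^sub>\<infinity> x) = m /\<^sub>\<infinity> x" for x by (cases x) (auto simp: m)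
  have one: "1 *\<^sub>\<infinity> x = x" for x by (cases x) auto
  have "(x, y, z, w) \<in> configurations \<alpha> \<beta> \<alpha> \<beta> \<longleftrightarrow>
      (y = 1 /\<^sub>\<infinity> x \<and> z = x \<and> w = 1 /\<^sub>\<infinity> x) \<or>
      (z = (- 1) *\<^sub>\<infinity> x \<and> w = (- 1) *\<^sub>\<infinity> y \<and> y = k /\<^sub>\<infinity> x)" for x y z w
    unfolding configurations_iff unit_isogram_cases[OF norm_cayley norm_cayley norm_cayley norm_cayley assms]
      cayley_branch2_iff[OF assms] cayley_one_divide[symmetric]
    unfolding cayley_uminus[symmetric] cayley_eq_iff k_def ..
  then have "(x, y, z, w) \<in> configurations \<alpha> \<beta> \<alpha> \<beta> \<longleftrightarrow>
      (x, y, z, w) \<in> range (hyper_curve 1 1 1) \<union> range (hyper_curve k (- 1) m)" for x y z w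
    by (auto simp: hyper_curve_def one neg image_iff)
  then show ?thesis unfolding k_def m_def by (simp only: set_eq_iff split_paired_All simp_thms)
qed

section \<open>The two stated branches and their points at infinity\<close>

lemma uminus_infty_eq: "-\<^sub>\<infinity> x = (- 1) *\<^sub>\<infinity> x"
  by (cases x) auto

lemma divide_times_infty: "c \<noteq> 0 \<Longrightarrow> b /\<^sub>\<infinity> (c *\<^sub>\<infinity> x) = (b / c) /\<^sub>\<infinity> x"
  by (cases x) auto

lemma isogram_branch1_eq: "isogram_branch1 = range (hyper_curve 1 1 1)"
proof -
  have "1 *\<^sub>\<infinity> x = x" for x by (cases x) auto
  then show ?thesis by (auto simp: isogram_branch1_def hyper_curve_def)
qed

lemma isogram_branch2_eq:
  "\<beta> \<noteq> \<alpha> \<Longrightarrow> isogram_branch2 \<alpha> \<beta> =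
    range (hyper_curve ((\<alpha> + \<beta>) / (\<alpha> - \<beta>)) (- 1) ((\<beta> + \<alpha>) / (\<beta> - \<alpha>)))"
  by (auto simp: isogram_branch2_def hyper_curve_def uminus_infty_eq divide_times_infty)

text \<open>The entries x and e x are infinite only at x = infinity, the entries k/x and m/x only at
  x = 0. The two resulting points do not depend on \<open>k\<close>, \<open>e\<close>,
  \<open>m\<close>, so both branches contribute the same pair.\<close>

lemma hyper_curve_infinite_points:
  assumes "k \<noteq> 0" "e \<noteq> 0" "m \<noteq> 0"
  shows "{(x, y, z, w) \<in> range (hyper_curve k e m). x = \<infinity>\<^sub>\<real> \<or> y = \<infinity>\<^sub>\<real> \<or> z = \<infinity>\<^sub>\<real> \<or> w = \<infinity>\<^sub>\<real>} =
    {(\<infinity>\<^sub>\<real>, Some 0, \<infinity>\<^sub>\<real>, Some 0), (Some 0, \<infinity>\<^sub>\<real>, Some 0, \<infinity>\<^sub>\<real>)}" (is "?L = ?R")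
proof
  show "?L \<subseteq> ?R"
  proof
    fix p assume "p \<in> ?L"
    then obtain x where "p = hyper_curve k e m x"
      "x = \<infinity>\<^sub>\<real> \<or> k /\<^sub>\<infinity> x = \<infinity>\<^sub>\<real> \<or> e *\<^sub>\<infinity> x = \<infinity>\<^sub>\<real> \<or> m /\<^sub>\<infinity> x = \<infinity>\<^sub>\<real>"
      by (auto simp: hyper_curve_def)
    then show "p \<in> ?R" by (cases x) (auto simp: hyper_curve_def split: if_splits)
  qed
  have "hyper_curve k e m \<infinity>\<^sub>\<real> = (\<infinity>\<^sub>\<real>, Some 0, \<infinity>\<^sub>\<real>, Some 0)"
    "hyper_curve k e m (Some 0) = (Some 0, \<infinity>\<^sub>\<real>, Some 0, \<infinity>\<^sub>\<real>)"
    by (simp_all add: hyper_curve_def)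
  then have "(\<infinity>\<^sub>\<real>, Some 0, \<infinity>\<^sub>\<real>, Some 0) \<in> range (hyper_curve k e m)"
    "(Some 0, \<infinity>\<^sub>\<real>, Some 0, \<infinity>\<^sub>\<real>) \<in> range (hyper_curve k e m)"
    by (metis rangeI)+
  then show "?R \<subseteq> ?L" by simp
qed

theorem mainTheorem3:
  fixes \<alpha> \<beta> \<gamma> \<delta> :: real
  assumes "\<alpha> > 0" and "\<beta> > 0" and "\<beta> \<noteq> \<alpha>" and "\<gamma> = \<alpha>" and "\<delta> = \<beta>"
  shows "configurations \<alpha> \<beta> \<gamma> \<delta> = isogram_branch1 \<union> isogram_branch2 \<alpha> \<beta> \<and>
    diffeomorphic quadruple_atlas isogram_branch1
      vector_space_atlas (sphere (0::complex) 1) \<and>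
    diffeomorphic quadruple_atlas (isogram_branch2 \<alpha> \<beta>)
      vector_space_atlas (sphere (0::complex) 1) \<and>
    {(x, y, z, w) \<in> configurations \<alpha> \<beta> \<gamma> \<delta>. x = \<infinity>\<^sub>\<real> \<or> y = \<infinity>\<^sub>\<real> \<or> z = \<infinity>\<^sub>\<real> \<or> w = \<infinity>\<^sub>\<real>} =
      {(\<infinity>\<^sub>\<real>, Some 0, \<infinity>\<^sub>\<real>, Some 0), (Some 0, \<infinity>\<^sub>\<real>, Some 0, \<infinity>\<^sub>\<real>)}"
proof -
  define k m where "k = (\<alpha> + \<beta>) / (\<alpha> - \<beta>)" and "m = (\<beta> + \<alpha>) / (\<beta> - \<alpha>)"
  have nz: "k \<noteq> 0" "m \<noteq> 0" using assms by (simp_all add: k_def m_def)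
  have b2: "isogram_branch2 \<alpha> \<beta> = range (hyper_curve k (- 1) m)"
    unfolding k_def m_def using assms(3) by (rule isogram_branch2_eq)
  have conf: "configurations \<alpha> \<beta> \<gamma> \<delta> = range (hyper_curve 1 1 1) \<union> range (hyper_curve k (- 1) m)"
    unfolding k_def m_def assms(4,5) using assms(1-3) by (rule isogram_configurations)
  have Un: "{(x, y, z, w) \<in> A \<union> B. P x y z w} =
      {(x, y, z, w) \<in> A. P x y z w} \<union> {(x, y, z, w) \<in> B. P x y z w}"
    for A B :: "quadruple set" and P
    by auto
  have one: "(1::real) \<noteq> 0" "(- 1::real) \<noteq> 0" by simp_all
  have "{(x, y, z, w) \<in> configurations \<alpha> \<beta> \<gamma> \<delta>. x = \<infinity>\<^sub>\<real> \<or> y = \<infinity>\<^sub>\<real> \<or> z = \<infinity>\<^sub>\<real> \<or> w = \<infinity>\<^sub>\<real>} =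
      {(\<infinity>\<^sub>\<real>, Some 0, \<infinity>\<^sub>\<real>, Some 0), (Some 0, \<infinity>\<^sub>\<real>, Some 0, \<infinity>\<^sub>\<real>)}"
    unfolding conf Un hyper_curve_infinite_points[OF one(1) one(1) one(1)]
      hyper_curve_infinite_points[OF nz(1) one(2) nz(2)] by (rule Un_absorb)
  moreover have "diffeomorphic quadruple_atlas isogram_branch1
      vector_space_atlas (sphere (0::complex) 1)"
    unfolding isogram_branch1_eq by (rule diffeomorphic_hyper_curve_circle) simp_all
  moreover have "diffeomorphic quadruple_atlas (isogram_branch2 \<alpha> \<beta>)
      vector_space_atlas (sphere (0::complex) 1)"
    unfolding b2 using nz by (intro diffeomorphic_hyper_curve_circle) simp_all
  moreover have "configurations \<alpha> \<beta> \<gamma> \<delta> = isogram_branch1 \<union> isogram_branch2 \<alpha> \<beta>"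
    unfolding conf b2 isogram_branch1_eq ..
  ultimately show ?thesis by (intro conjI)
qed

end
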